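(* Let $h,k$ be coprime positive integers and let $\Delta\subset\mathbb{R}^2$ be the closed triangle with vertices $(0,0)$, $(h,0)$ and $(0,k)$. Then for every nonzero real number $t$, \begin{align*} A_{\Delta}(t) &= \frac{hk}{2}t^2-\bar{B}_1(hkt)\,t + \frac{1}{2hk}\left(\bar{B}_2(hkt)+\frac{h^2+k^2}{6}\right) \\ &\quad -s(h,k;ht,0)-s(k,h;kt,0) - \frac{\arctan(h/k)}{2\pi}\mathbf{1}_{\mathbb{Z}}(ht) - \frac{\arctan(k/h)}{2\pi}\mathbf{1}_{\mathbb{Z}}(kt). \end{align*}
   Context: For a closed polygon $\mathcal{P}\subset\mathbb{R}^2$ and $x\in\mathbb{R}^2$, the solid angle $\omega_{\mathcal{P}}(x)$ is $1$ if $x$ is in the interior of $\mathcal{P}$, $0$ if $x\notin\mathcal{P}$, $1/2$ if $x$ lies in the relative interior of an edge of $\mathcal{P}$, and $\theta_x/(2\pi)$ if $x$ is a vertex of $\mathcal{P}$ with interior angle $\theta_x$ (in radians). For real $t$, $t\mathcal{P}=\{tx: x\in\mathcal{P}\}$, and Macdonald's solid-angle sum is $A_{\mathcal{P}}(t)=\sum_{x\in\mathbb{Z}^2}\omega_{t\mathcal{P}}(x)$. The function $B_1(x)$ equals $x-\tfrac12$ for $x\in(0,1)$ and $0$ otherwise; $B_2(x)$ equals $x^2-x+\tfrac16$ for $x\in[0,1]$ and $0$ otherwise; $\bar{B}_j(x):=B_j(x-\lfloor x\rfloor)$ for $j=1,2$ (so $\bar B_1$ vanishes at integers). The Dedekind–Rademacher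 sum is $s(h,k;y,x)=\sum_{r \bmod k}\bar{B}_1\!\left(h\frac{r+x}{k}+y\right)\bar{B}_1\!\left(\frac{r+x}{k}\right)$ for coprime positive integers $h,k$ and real $x,y$. $\mathbf{1}_{\mathbb{Z}}$ is the indicator function of the integers. *)

theory Defs
  imports "HOL-Analysis.Analysis"
begin

definition angle_between :: "real \<times> real \<Rightarrow> real \<times> real \<Rightarrow> real" where
  "angle_between u v = arccos (inner u v / (norm u * norm v))"

text \<open>
  The solid angle is defined for convex polygons, whose vertices and edges are their extreme
  points and one-dimensional faces. Exactly two edges meet at a vertex of such a polygon, and the
  interior angle is the angle between them.
\<close>

definition interior_angle :: "(real \<times> real) set \<Rightarrow> real \<times> real \<Rightarrow> real" where
  "interior_angle P x =
     (THE \<theta>. \<exists>a b. a \<noteq> b \<and> closed_segment x a edge_of P \<and> closed_segment x b edge_of P \<and>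
                \<theta> = angle_between (a - x) (b - x))"

definition solid_angle :: "(real \<times> real) set \<Rightarrow> real \<times> real \<Rightarrow> real" where
  "solid_angle P x =
     (if x \<in> interior P then 1
      else if x \<notin> P then 0
      else if \<exists>e. e edge_of P \<and> x \<in> rel_interior e then 1 / 2
      else if x extreme_point_of P then interior_angle P x / (2 * pi)
      else 0)"

text \<open>The sum has only finitely many nonzero terms, since polygons are bounded.\<close>

definition solid_angle_sum :: "(real \<times> real) set \<Rightarrow> real \<Rightarrow> real" where
  "solid_angle_sum P t = (\<Sum>\<^sub>\<infinity>x \<in> \<int> \<times> \<int>. solid_angle ((*\<^sub>R) t ` P) x)"

definition B1 :: "real \<Rightarrow> real" where
  "B1 x = (if x \<in> {0<..<1} then x - 1 / 2 else 0)"

definition B2 :: "real \<Rightarrow> real" where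
  "B2 x = (if x \<in> {0..1} then x\<^sup>2 - x + 1 / 6 else 0)"

definition B1_bar :: "real \<Rightarrow> real" where
  "B1_bar x = B1 (x - of_int \<lfloor>x\<rfloor>)"

definition B2_bar :: "real \<Rightarrow> real" where
  "B2_bar x = B2 (x - of_int \<lfloor>x\<rfloor>)"

text \<open>The summand is \<open>k\<close>-periodic in \<open>r\<close>; we sum over the residues \<open>0, \<dots>, k - 1\<close>.\<close>

definition dedekind_rademacher_sum :: "nat \<Rightarrow> nat \<Rightarrow> real \<Rightarrow> real \<Rightarrow> real" where
  "dedekind_rademacher_sum h k y x =
     (\<Sum>r<k. B1_bar (real h * ((real r + x) / real k) + y) * B1_bar ((real r + x) / real k))"

end

theory Submission
  imports Defs "HOL-Number_Theory.Cong"
begin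

text \<open>
  Let \<open>H\<close> be the step function with \<open>H 0 = 1/2\<close> and put \<open>T = h k \<bar>t\<bar>\<close>. Apart from the two acute
  vertices, where the defect is an arctangent, the solid angle of the dilated triangle at the lattice
  point \<open>\<plusminus> (m, n)\<close> is the product \<open>H m \<cdot> H n \<cdot> H (T - k m - h n)\<close>. Call the sum of these products
  \<open>L T\<close> and the claimed quasi-polynomial \<open>R T\<close>.

  Summing \<open>L\<close> by columns shows that \<open>L (T + k) - L T\<close> involves only the two columns of height
  \<open>T / h\<close> and \<open>(T + k) / h\<close>, and shifting the summation index in the Dedekind-Rademacher sum shows that
  \<open>R\<close> has the same increment. By symmetry the same holds for \<open>T + h\<close>, so by Bezout \<open>L - R\<close> is
  1-periodic on \<open>T > 0\<close>. It vanishes for \<open>0 < T < 1\<close> and for \<open>T = k\<close>, both by the reciprocity law for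
  Dedekind sums. Reciprocity is in turn obtained by summing
  \<open>(B\<^sub>1 u + B\<^sub>1 v - B\<^sub>1 (u + v))\<^sup>2 \<in> {0, 1/4}\<close> over the grid \<open>u \<in> \<int>/h\<close>, \<open>v \<in> \<int>/k\<close>.
\<close>

section \<open>Periodic Bernoulli functions and Dedekind reciprocity\<close>

lemma B1_bar_eq_frac: "B1_bar x = (if x \<in> \<int> then 0 else frac x - 1 / 2)"
proof -
  have "frac x > 0 \<longleftrightarrow> x \<notin> \<int>" "frac x < 1"
    by (auto simp: frac_lt_1 frac_gt_0_iff)
  then show ?thesis
    unfolding B1_bar_def B1_def frac_def[symmetric] by auto
qed

lemma B2_bar_eq_frac: "B2_bar x = (frac x)\<^sup>2 - frac x + 1 / 6"
proof -
  have "frac x \<ge> 0" "frac x < 1" by (auto simp: frac_lt_1)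
  then show ?thesis by (auto simp: B2_bar_def B2_def frac_def)
qed

lemma B1_bar_Ints [simp]: "x \<in> \<int> \<Longrightarrow> B1_bar x = 0"
  by (simp add: B1_bar_eq_frac)

lemma B1_bar_add_one [simp]: "B1_bar (x + 1) = B1_bar x"
  by (simp add: B1_bar_def)

lemma B2_bar_add_one [simp]: "B2_bar (x + 1) = B2_bar x"
  by (simp add: B2_bar_def)

lemma B1_bar_minus [simp]: "B1_bar (- x) = - B1_bar x"
  by (auto simp: B1_bar_eq_frac frac_neg)

lemma B2_bar_minus [simp]: "B2_bar (- x) = B2_bar x"
  by (auto simp: B2_bar_eq_frac frac_neg power2_eq_square algebra_simps)

lemma B1_bar_unit_interval: "0 < x \<Longrightarrow> x < 1 \<Longrightarrow> B1_bar x = x - 1 / 2"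
  by (simp add: B1_bar_def B1_def floor_unique[of 0])

section \<open>Sums of 1-periodic functions over equidistant points\<close>

lemma periodic_add_int:
  fixes f :: "real \<Rightarrow> 'a"
  assumes per: "\<And>x. f (x + 1) = f x"
  shows "f (x + of_int n) = f x"
proof -
  have nat: "f (x + real m) = f x" for x m
    by (induction m) (auto simp: per[of "x + real _", simplified add.assoc] add.commute[of 1])
  show ?thesis
  proof (cases "n \<ge> 0")
    case True
    then show ?thesis using nat[of x "nat n"] by simp
  next
    case False
    then show ?thesis using nat[of "x + of_int n" "nat (- n)"] by simp
  qed
qed

lemma periodic_div_cong:
  fixes f :: "real \<Rightarrow> 'a"
  assumes per: "\<And>x. f (x + 1) = f x" and n: "0 < n" and ab: "[a = b] (mod int n)"
  shows "f (of_int a / real n) = f (of_int b / real n)"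
proof -
  obtain c where "a = b + c * int n"
    using ab by (metis cong_iff_lin cong_sym mult.commute)
  then have "of_int a / real n = of_int b / real n + of_int c"
    using n by (simp add: field_simps)
  then show ?thesis using periodic_add_int[of f, OF per] by simp
qed

text \<open>Multiplication by the unit \<open>c\<close> permutes the residues modulo
  \<open>n\<close>, and \<open>f (r / n)\<close> depends only on the residue of
  \<open>r\<close>.\<close>

lemma sum_periodic_mult_coprime:
  fixes f :: "real \<Rightarrow> real" and c :: int
  assumes per: "\<And>x. f (x + 1) = f x" and n: "0 < n" and cop: "coprime c (int n)"
  shows "(\<Sum>r<n. f (of_int c * real r / real n)) = (\<Sum>r<n. f (real r / real n))"
proof -
  define \<sigma> where "\<sigma> r = nat (c * int r mod int n)" for r :: nat
  have \<sigma>: "int (\<sigma> r) = c * int r mod int n" for r using n by (simp add: \<sigma>_def)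
  have "\<sigma> ` {..<n} \<subseteq> {..<n}"
    using n by (auto simp: \<sigma>_def nat_less_iff)
  moreover have "inj_on \<sigma> {..<n}"
  proof (rule inj_onI)
    fix r s assume "r \<in> {..<n}" "s \<in> {..<n}" "\<sigma> r = \<sigma> s"
    then have "[c * int r = c * int s] (mod int n)"
      using \<sigma> unfolding cong_def by metis
    then have "[int r = int s] (mod int n)"
      using cop by (simp add: cong_mult_lcancel)
    with \<open>r \<in> _\<close> \<open>s \<in> _\<close> show "r = s" by (simp add: cong_def)
  qed
  ultimately have bij: "bij_betw \<sigma> {..<n} {..<n}"
    by (simp add: bij_betw_def endo_inj_surj)
  have "f (of_int c * real r / real n) = f (real (\<sigma> r) / real n)" for r
  proof -
    have "[c * int r = int (\<sigma> r)] (mod int n)" by (simp add: \<sigma> cong_def)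
    from periodic_div_cong[of f, OF per n this] show ?thesis by simp
  qed
  then have "(\<Sum>r<n. f (of_int c * real r / real n)) = (\<Sum>r<n. f (real (\<sigma> r) / real n))"
    by simp
  also have "\<dots> = (\<Sum>r<n. f (real r / real n))"
    by (rule sum.reindex_bij_betw[OF bij])
  finally show ?thesis .
qed

lemma sum_periodic_shift:
  fixes f :: "real \<Rightarrow> real"
  assumes per: "\<And>x. f (x + 1) = f x" and n: "0 < n"
  shows "(\<Sum>r<n. f (x + (real r + 1) / real n)) = (\<Sum>r<n. f (x + real r / real n))"
proof -
  have "(\<Sum>r<n. f (x + (real r + 1) / real n)) - (\<Sum>r<n. f (x + real r / real n))
      = (\<Sum>r<n. f (x + real (Suc r) / real n) - f (x + real r / real n))"
    by (simp add: sum_subtractf add.commute)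
  also have "\<dots> = f (x + real n / real n) - f (x + real 0 / real n)"
    by (rule sum_lessThan_telescope)
  also have "\<dots> = 0" using n per by simp
  finally show ?thesis by simp
qed

text \<open>Distribution relation of the first Bernoulli function. Both sides have period 1 in
  \<open>x\<close>, so \<open>0 \<le> x < 1\<close> suffices, and there the summands are linear in
  \<open>r\<close>.\<close>

lemma sum_B1_bar_equidistant:
  assumes n: "0 < n"
  shows "(\<Sum>r<n. B1_bar ((x + real r) / real n)) = B1_bar x"
proof -
  define \<phi> where "\<phi> x = (\<Sum>r<n. B1_bar ((x + real r) / real n)) - B1_bar x" for x
  have per: "\<phi> (x + 1) = \<phi> x" for x
    using sum_periodic_shift[of B1_bar n "x / real n"] n
      B1_bar_add_one[of x]
    by (simp add: \<phi>_def add_divide_distrib add_ac)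
  have unit: "\<phi> x = 0" if x: "0 \<le> x" "x < 1" for x
  proof -
    \<comment> \<open>The only integer argument is \<open>x = r = 0\<close>, where the value 0
      replaces \<open>- 1 / 2\<close>.\<close>
    have "B1_bar ((x + real r) / real n) = (x + real r) / real n - 1 / 2
        + (if r = 0 then if x = 0 then 1 / 2 else 0 else 0)" if "r < n" for r
    proof (cases "r = 0 \<and> x = 0")
      case False
      moreover have "real r \<le> real n - 1" using that by linarith
      ultimately show ?thesis using x n
        by (subst B1_bar_unit_interval) (auto simp: field_simps)
    qed auto
    then have "(\<Sum>r<n. B1_bar ((x + real r) / real n)) = (\<Sum>r<n. (x + real r) / real n - 1 / 2
        + (if r = 0 then if x = 0 then 1 / 2 else 0 else 0))"
      by (intro sum.cong) auto
    also have "\<dots> = (\<Sum>r<n. (x + real r) / real n) - real n / 2 + (if x = 0 then 1 / 2 else 0)"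
      using n by (simp add: sum.distrib sum_subtractf)
    also have "(\<Sum>r<n. (x + real r) / real n) = x + (real n - 1) / 2"
    proof -
      have "(\<Sum>r<m. real r) = real m * (real m - 1) / 2" for m
        by (induction m) (auto simp: field_simps)
      then show ?thesis
        using n by (simp add: sum_divide_distrib[symmetric] sum.distrib field_simps)
    qed
    finally show ?thesis using x
      by (cases "x = 0") (auto simp: \<phi>_def B1_bar_unit_interval field_simps)
  qed
  have "\<phi> x = \<phi> (frac x + of_int \<lfloor>x\<rfloor>)" by (simp add: frac_def)
  also have "\<dots> = 0" using periodic_add_int[of \<phi>, OF per] unit by (simp add: frac_lt_1)
  finally show ?thesis by (simp add: \<phi>_def)
qed

text \<open>As \<open>k\<close> is a unit modulo \<open>h\<close>, \<open>k * r\<close> may be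
  replaced by \<open>r\<close>; the distribution relation does the rest.\<close>

lemma sum_B1_bar_coprime:
  assumes h: "0 < h" and cop: "coprime h k"
  shows "(\<Sum>r<h. B1_bar ((real k * real r + x) / real h)) = B1_bar x"
proof -
  have per: "B1_bar (u + 1 + x / real h) = B1_bar (u + x / real h)" for u
    using B1_bar_add_one[of "u + x / real h"] by (simp add: add_ac)
  have "(\<Sum>r<h. B1_bar (of_int (int k) * real r / real h + x / real h))
      = (\<Sum>r<h. B1_bar (real r / real h + x / real h))"
    using h cop
    by (intro sum_periodic_mult_coprime[where f = "\<lambda>u. B1_bar (u + x / real h)"])
       (auto simp: coprime_commute per)
  then show ?thesis
    using sum_B1_bar_equidistant[OF h, of x] by (simp add: add_divide_distrib add_ac)
qed

text \<open>A form of the Chinese remainder theorem: the fractions \<open>i / h + j / k\<close> run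
  modulo 1 through all \<open>N / (h k)\<close>.\<close>

lemma sum_grid_coprime:
  fixes f :: "real \<Rightarrow> real"
  assumes per: "\<And>x. f (x + 1) = f x" and h: "0 < h" and k: "0 < k" and cop: "coprime h k"
  shows "(\<Sum>i<h. \<Sum>j<k. f (real i / real h + real j / real k))
    = (\<Sum>N<h * k. f (real N / (real h * real k)))"
proof -
  \<comment> \<open>The argument is scaled by \<open>k\<close>, so that raising it by 1 merely
    shifts \<open>j\<close>. Then \<open>i / h\<close> enters as \<open>G (k i / h)\<close>, and
    \<open>k i\<close> can be replaced by \<open>i\<close>.\<close>
  define G where "G x = (\<Sum>j<k. f (x / real k + real j / real k))" for x
  have G: "G (x + 1) = G x" for x
    using sum_periodic_shift[of f k "x / real k", OF per k]
    by (simp add: G_def add_divide_distrib add_ac)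
  have "(\<Sum>i<h. \<Sum>j<k. f (real i / real h + real j / real k))
      = (\<Sum>i<h. G (of_int (int k) * real i / real h))"
    using k by (simp add: G_def)
  also have "\<dots> = (\<Sum>i<h. G (real i / real h))"
    using sum_periodic_mult_coprime[of G h "int k", OF G h] cop by (simp add: coprime_commute)
  also have "\<dots> = (\<Sum>j<k. \<Sum>i<h. f (real (i + j * h) / (real h * real k)))"
    unfolding G_def using h k by (subst sum.swap) (simp add: field_simps)
  also have "\<dots> = (\<Sum>N<k * h. f (real N / (real h * real k)))"
    using sum.nat_group[of "\<lambda>N. f (real N / (real h * real k))" h k]
    by (simp add: sum.shift_bounds_nat_ivl[of _ 0 "_ * h" h, simplified] lessThan_atLeast0 add.commute)
  finally show ?thesis by (simp add: mult.commute)
qed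

section \<open>The reciprocity law\<close>

lemma sum_B1_bar_square:
  assumes n: "0 < n"
  shows "(\<Sum>r<n. (B1_bar (real r / real n))\<^sup>2) = (real n - 1) * (real n - 2) / (12 * real n)"
proof -
  \<comment> \<open>The upper limit \<open>m\<close> is kept apart from the denominator
    \<open>n\<close>, so that induction on it is possible.\<close>
  have sq: "(\<Sum>r<m. (real r / real n - 1 / 2)\<^sup>2)
      = real m * (real m - 1) * (2 * real m - 1) / (6 * (real n)\<^sup>2)
        - real m * (real m - 1) / (2 * real n) + real m / 4" for m
  proof (induction m)
    case (Suc m)
    show ?case
      unfolding sum.lessThan_Suc Suc.IH using n by (simp add: field_simps power2_eq_square)
  qed simp
  have "(B1_bar (real r / real n))\<^sup>2 = (real r / real n - 1 / 2)\<^sup>2 - (if r = 0 then 1 / 4 else 0)"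
    if "r < n" for r
    using that n by (cases "r = 0") (auto simp: B1_bar_unit_interval power2_eq_square)
  then have "(\<Sum>r<n. (B1_bar (real r / real n))\<^sup>2)
      = (\<Sum>r<n. (real r / real n - 1 / 2)\<^sup>2 - (if r = 0 then 1 / 4 else 0))"
    by (intro sum.cong) auto
  also have "\<dots> = (\<Sum>r<n. (real r / real n - 1 / 2)\<^sup>2) - 1 / 4"
    using n by (simp add: sum_subtractf)
  also have "\<dots> = (real n - 1) * (real n - 2) / (12 * real n)"
    unfolding sq using n by (simp add: field_simps power2_eq_square)
  finally show ?thesis .
qed

text \<open>\<open>frac (u + v)\<close> is \<open>frac u + frac v\<close> or one less, so the
  expression before squaring is \<open>- 1 / 2\<close> or \<open>1 / 2\<close>.\<close>

lemma B1_bar_three_term: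
  assumes "u \<notin> \<int>" "v \<notin> \<int>" "u + v \<notin> \<int>"
  shows "(B1_bar u + B1_bar v - B1_bar (u + v))\<^sup>2 = 1 / 4"
  using assms by (auto simp: B1_bar_eq_frac frac_add power2_eq_square field_simps)

text \<open>Clearing denominators gives \<open>i k + j h = z h k\<close>; hence \<open>h\<close>
  divides \<open>i k\<close>, thus \<open>i\<close>, and likewise \<open>k\<close> divides
  \<open>j\<close>.\<close>

lemma fraction_sum_Ints_coprime:
  assumes "0 < h" "0 < k" "coprime h k" "i < h" "j < k"
    and "real i / real h + real j / real k \<in> \<int>"
  shows "i = 0 \<and> j = 0"
proof -
  obtain z where z: "real i / real h + real j / real k = of_int z"
    using assms(6) Ints_cases by blast
  then have "real i * real k + real j * real h = of_int z * (real h * real k)"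
    using assms(1,2) by (simp add: field_simps)
  then have "real_of_int (int i * int k + int j * int h) = of_int (z * (int h * int k))" by simp
  then have e: "int i * int k + int j * int h = z * (int h * int k)" by (simp only: of_int_eq_iff)
  have "int i * int k = int h * (z * int k - int j)" using e by (simp add: algebra_simps)
  then have "int h dvd int i * int k" by simp
  then have "h dvd i" using assms(3) by (simp add: coprime_dvd_mult_left_iff)
  moreover have "int j * int h = int k * (z * int h - int i)" using e by (simp add: algebra_simps)
  then have "int k dvd int j * int h" by simp
  then have "k dvd j" using assms(3) by (simp add: coprime_dvd_mult_left_iff coprime_commute)
  ultimately show ?thesis using assms(4,5) by (meson dvd_imp_le leD neq0_conv)
qed

text \<open>The double sum \<open>S\<close> of squares is evaluated twice: termwise by the
  three-term relation, and by expanding the square, where two of the mixed products yield the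
  Dedekind sums.\<close>

theorem dedekind_reciprocity:
  assumes h: "0 < h" and k: "0 < k" and cop: "coprime h k"
  shows "dedekind_rademacher_sum h k 0 0 + dedekind_rademacher_sum k h 0 0
    = - 1 / 4 + ((real h)\<^sup>2 + (real k)\<^sup>2 + 1) / (12 * real h * real k)"
proof -
  define u where "u i = real i / real h" for i
  define v where "v j = real j / real k" for j
  define S where "S = (\<Sum>i<h. \<Sum>j<k. (B1_bar (u i) + B1_bar (v j) - B1_bar (u i + v j))\<^sup>2)"
  \<comment> \<open>On the axes \<open>i = 0\<close> or \<open>j = 0\<close> the bracket vanishes.
    Writing the value as a product makes the double sum factor.\<close>
  have "(B1_bar (u i) + B1_bar (v j) - B1_bar (u i + v j))\<^sup>2
      = (if i = 0 then 0 else 1 / 2) * (if j = 0 then 0 else 1 / 2)"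
    if "i < h" "j < k" for i j
  proof (cases "i = 0 \<or> j = 0")
    case False
    have "x / y \<notin> \<int>" if "0 < x" "x < y" for x y :: real
    proof
      assume "x / y \<in> \<int>"
      then obtain z where "x / y = of_int z" using Ints_cases by blast
      moreover have "0 < x / y" "x / y < 1" using that by auto
      ultimately show False by simp
    qed
    then have "u i \<notin> \<int>" "v j \<notin> \<int>" using False that by (auto simp: u_def v_def)
    moreover have "u i + v j \<notin> \<int>"
      using fraction_sum_Ints_coprime[OF h k cop that] False by (auto simp: u_def v_def)
    ultimately show ?thesis using False by (simp add: B1_bar_three_term)
  qed (auto simp: u_def v_def)
  then have "S = (\<Sum>i<h. \<Sum>j<k. (if i = 0 then 0 else 1 / 2) * (if j = 0 then 0 else 1 / 2))"
    unfolding S_def by (intro sum.cong) auto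
  also have "\<dots> = (\<Sum>i<h. if i = 0 then 0 else 1 / 2) * (\<Sum>j<k. if j = 0 then 0 else 1 / 2)"
    by (simp only: sum_product)
  also have "\<dots> = (real h - 1) / 2 * ((real k - 1) / 2)"
  proof -
    have "(\<Sum>i<n. if i = 0 then 0 else 1 / 2 :: real) = (real n - 1) / 2" if "0 < n" for n :: nat
    proof -
      have "(\<Sum>i<n. if i = 0 then 0 else 1 / 2 :: real) = (\<Sum>i<n. 1 / 2 - (if i = 0 then 1 / 2 else 0))"
        by (intro sum.cong) auto
      also have "\<dots> = real n / 2 - 1 / 2" using that by (simp add: sum_subtractf)
      finally show ?thesis by (simp add: diff_divide_distrib)
    qed
    then show ?thesis using h k by (simp only:)
  qed
  finally have S1: "S = (real h - 1) * (real k - 1) / 4" by simp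
  \<comment> \<open>Summing out one variable by the distribution relation turns a mixed product into
    the summand of a Dedekind sum.\<close>
  have col: "(\<Sum>j<k. B1_bar (u i + v j)) = B1_bar (real k * u i)" for i
    using sum_B1_bar_equidistant[OF k, of "real k * u i"] k
    by (simp add: v_def add_divide_distrib)
  have row: "(\<Sum>i<h. B1_bar (u i + v j)) = B1_bar (real h * v j)" for j
    using sum_B1_bar_equidistant[OF h, of "real h * v j"] h
    by (simp add: u_def add_divide_distrib add.commute)
  \<comment> \<open>This removes the mixed product of \<open>B1_bar (u i)\<close> and
    \<open>B1_bar (v j)\<close>.\<close>
  have zero: "(\<Sum>i<h. B1_bar (u i)) = 0"
    using sum_B1_bar_equidistant[OF h, of 0] by (simp add: u_def)
  have "S = (\<Sum>i<h. \<Sum>j<k. (B1_bar (u i))\<^sup>2 + (B1_bar (v j))\<^sup>2 + (B1_bar (u i + v j))\<^sup>2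
      + 2 * (B1_bar (u i) * B1_bar (v j))
      - 2 * (B1_bar (u i) * B1_bar (u i + v j)) - 2 * (B1_bar (v j) * B1_bar (u i + v j)))"
    unfolding S_def by (simp add: power2_eq_square algebra_simps)
  also have "\<dots> = real k * (\<Sum>i<h. (B1_bar (u i))\<^sup>2) + real h * (\<Sum>j<k. (B1_bar (v j))\<^sup>2)
      + (\<Sum>i<h. \<Sum>j<k. (B1_bar (u i + v j))\<^sup>2)
      + 2 * ((\<Sum>i<h. B1_bar (u i)) * (\<Sum>j<k. B1_bar (v j)))
      - 2 * (\<Sum>i<h. B1_bar (u i) * (\<Sum>j<k. B1_bar (u i + v j)))
      - 2 * (\<Sum>i<h. \<Sum>j<k. B1_bar (v j) * B1_bar (u i + v j))"
    by (simp add: sum.distrib sum_subtractf sum_product flip: sum_distrib_left)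
  also have "(\<Sum>i<h. \<Sum>j<k. B1_bar (v j) * B1_bar (u i + v j)) = dedekind_rademacher_sum h k 0 0"
    unfolding sum.swap[of _ "{..<k}"] sum_distrib_left[symmetric] row
    by (simp add: dedekind_rademacher_sum_def v_def mult.commute)
  also have "(\<Sum>i<h. B1_bar (u i) * (\<Sum>j<k. B1_bar (u i + v j))) = dedekind_rademacher_sum k h 0 0"
    unfolding col by (simp add: dedekind_rademacher_sum_def u_def mult.commute)
  also have "(\<Sum>i<h. \<Sum>j<k. (B1_bar (u i + v j))\<^sup>2) = (\<Sum>N<h * k. (B1_bar (real N / real (h * k)))\<^sup>2)"
    using sum_grid_coprime[of "\<lambda>x. (B1_bar x)\<^sup>2", OF _ h k cop] by (simp add: u_def v_def)
  also have "\<dots> = (real (h * k) - 1) * (real (h * k) - 2) / (12 * real (h * k))"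
    using h k by (intro sum_B1_bar_square) auto
  also have "(\<Sum>i<h. (B1_bar (u i))\<^sup>2) = (real h - 1) * (real h - 2) / (12 * real h)"
    unfolding u_def by (rule sum_B1_bar_square[OF h])
  also have "(\<Sum>j<k. (B1_bar (v j))\<^sup>2) = (real k - 1) * (real k - 2) / (12 * real k)"
    unfolding v_def by (rule sum_B1_bar_square[OF k])
  \<comment> \<open>Clearing denominators leaves a surplus factor \<open>h k\<close>, cancelled
    next.\<close>
  finally have "(real h * real k) * (12 * real h * real k
      * (dedekind_rademacher_sum h k 0 0 + dedekind_rademacher_sum k h 0 0)
      + 3 * real h * real k - ((real h)\<^sup>2 + (real k)\<^sup>2 + 1)) = 0"
    unfolding S1 zero using h k by (simp add: field_simps power2_eq_square)
  then have "12 * real h * real k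
      * (dedekind_rademacher_sum h k 0 0 + dedekind_rademacher_sum k h 0 0)
      + 3 * real h * real k - ((real h)\<^sup>2 + (real k)\<^sup>2 + 1) = 0"
    using h k by simp
  then show ?thesis using h k by (simp add: field_simps)
qed

section \<open>The weighted lattice point count\<close>

definition half_step :: "real \<Rightarrow> real" where
  "half_step x = (1 + sgn x) / 2"

lemma half_step_simps [simp]:
  "x < 0 \<Longrightarrow> half_step x = 0" "half_step 0 = 1 / 2" "0 < x \<Longrightarrow> half_step x = 1"
  by (auto simp: half_step_def)

lemma half_step_cmult: "0 < c \<Longrightarrow> half_step (c * x) = half_step x"
  by (simp add: half_step_def sgn_mult)

text \<open>For \<open>T > 0\<close> this weights the lattice points of the triangle
  \<open>k x + h y \<le> T\<close> in the first quadrant: 1 inside, \<open>1 / 2\<close> on edges,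
  \<open>1 / 4\<close> at all three vertices. For positive \<open>h\<close> and \<open>k\<close> the
  cutoff loses no nonzero term.\<close>

definition weighted_lattice_count :: "nat \<Rightarrow> nat \<Rightarrow> real \<Rightarrow> real" where
  "weighted_lattice_count h k T = (\<Sum>m\<le>nat \<lceil>T\<rceil>. \<Sum>n\<le>nat \<lceil>T\<rceil>.
     half_step (real m) * half_step (real n) * half_step (T - real k * real m - real h * real n))"

text \<open>An index beyond \<open>T\<close> makes the last argument negative, since
  \<open>h\<close> and \<open>k\<close> are at least 1. A flexible cutoff is what the column
  arguments need.\<close>

lemma weighted_lattice_count_eq:
  assumes h: "0 < h" and k: "0 < k" and M: "T \<le> real M"
  shows "weighted_lattice_count h k T = (\<Sum>m\<le>M. \<Sum>n\<le>M.
     half_step (real m) * half_step (real n) * half_step (T - real k * real m - real h * real n))"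
proof -
  have "half_step (T - real k * real m - real h * real n) = 0"
    if "m > nat \<lceil>T\<rceil> \<or> n > nat \<lceil>T\<rceil>" for m n :: nat
  proof -
    have "real m \<le> real k * real m" "real n \<le> real h * real n"
      using h k by (simp_all add: mult_le_cancel_right1)
    moreover have "T < real m \<or> T < real n" using that by linarith
    ultimately have "T - real k * real m - real h * real n < 0" by linarith
    then show ?thesis by simp
  qed
  moreover have "nat \<lceil>T\<rceil> \<le> M" using M by (simp add: nat_le_iff ceiling_le_iff)
  ultimately show ?thesis
    unfolding weighted_lattice_count_def sum.cartesian_product
    by (intro sum.mono_neutral_left) (auto simp del: nat_ceiling_le_eq, (meson not_le)+)
qed

lemma weighted_lattice_count_commute:
  "weighted_lattice_count h k T = weighted_lattice_count k h T"
  unfolding weighted_lattice_count_def by (subst sum.swap) (simp add: algebra_simps)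

text \<open>The weight of a lattice column of real height \<open>y\<close>, both ends counted half.
  At \<open>y = 0\<close> the ends coincide, which gives \<open>1 / 4\<close>, whereas
  \<open>y - B1_bar y\<close> would be 0.\<close>

definition column_count :: "real \<Rightarrow> real" where
  "column_count y = (if y < 0 then 0 else if y = 0 then 1 / 4 else y - B1_bar y)"

lemma column_count_0 [simp]: "column_count 0 = 1 / 4"
  by (simp add: column_count_def)

lemma column_count_pos [simp]: "0 < y \<Longrightarrow> column_count y = y - B1_bar y"
  by (simp add: column_count_def)

text \<open>Dropping the point \<open>n = 0\<close> lowers the height by one, which drives the
  induction.\<close>

lemma sum_half_step:
  assumes "0 \<le> y" "y \<le> real M"
  shows "(\<Sum>n\<le>M. half_step (y - real n)) = y - B1_bar y + 1 / 2"
  using assms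
proof (induction M arbitrary: y)
  case (Suc M)
  have split: "(\<Sum>n\<le>Suc M. half_step (y - real n)) = half_step y + (\<Sum>n\<le>M. half_step (y - 1 - real n))"
    by (subst sum.atMost_Suc_shift) (simp add: algebra_simps)
  show ?case
  proof (cases "y < 1")
    case True
    then show ?thesis using Suc.prems
      unfolding split by (cases "y = 0") (simp_all add: B1_bar_unit_interval)
  next
    case False
    then show ?thesis
      using Suc.IH[of "y - 1"] Suc.prems B1_bar_add_one[of "y - 1"] unfolding split by simp
  qed
qed simp

lemma sum_column:
  assumes "y \<le> real M"
  shows "(\<Sum>n\<le>M. half_step (real n) * half_step (y - real n)) = column_count y"
proof (cases "0 \<le> y")
  case True
  have "(\<Sum>n\<le>M. half_step (real n) * half_step (y - real n))
      = (\<Sum>n\<le>M. half_step (y - real n) - (if n = 0 then half_step y / 2 else 0))"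
    by (intro sum.cong) auto
  also have "\<dots> = y - B1_bar y + 1 / 2 - half_step y / 2"
    using True assms by (simp add: sum_subtractf sum_half_step)
  finally show ?thesis using True by (cases "y = 0") (auto simp: column_count_def)
qed (simp add: column_count_def)

text \<open>Dividing the last argument by the positive \<open>h\<close> shows that the points with
  first coordinate \<open>m\<close> form a column of height \<open>(T - k m) / h\<close>.\<close>

lemma weighted_lattice_count_columns:
  assumes h: "0 < h" and k: "0 < k" and T: "0 \<le> T" "T \<le> real M"
  shows "weighted_lattice_count h k T
    = (\<Sum>m\<le>M. half_step (real m) * column_count ((T - real k * real m) / real h))"
proof -
  have "half_step (T - real k * real m - real h * real n)
      = half_step ((T - real k * real m) / real h - real n)" for m n
    using half_step_cmult[of "real h" "(T - real k * real m) / real h - real n"] h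
    by (simp add: right_diff_distrib[of "real h" "_ / _"])
  moreover have "(T - real k * real m) / real h \<le> real M" for m
  proof -
    have "0 \<le> real k * real m" by simp
    then have "T - real k * real m \<le> real M * 1" using T by linarith
    also have "\<dots> \<le> real M * real h" using h by (intro mult_left_mono) auto
    finally show ?thesis using h by (simp add: divide_le_eq)
  qed
  ultimately show ?thesis
    unfolding weighted_lattice_count_eq[OF h k T(2)]
    by (simp add: sum_column mult.assoc flip: sum_distrib_left)
qed

text \<open>Column \<open>m + 1\<close> for \<open>T + k\<close> is column \<open>m\<close> for
  \<open>T\<close>. The new column 0 enters with weight one half, and the old column 0 rises from
  weight one half to 1.\<close>

lemma weighted_lattice_count_shift:
  assumes h: "0 < h" and k: "0 < k" and T: "0 \<le> T"
  shows "weighted_lattice_count h k (T + real k) = weighted_lattice_count h k T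
    + (column_count (T / real h) + column_count ((T + real k) / real h)) / 2"
proof -
  define M where "M = nat \<lceil>T\<rceil> + k"
  have M: "T + real k \<le> real M" unfolding M_def using T by (simp add: of_nat_ceiling)
  define c where "c m = column_count ((T - real k * real m) / real h)" for m
  have "weighted_lattice_count h k (T + real k)
      = (\<Sum>m\<le>Suc M. half_step (real m) * column_count ((T + real k - real k * real m) / real h))"
    using M T by (intro weighted_lattice_count_columns[OF h k]) auto
  also have "\<dots> = column_count ((T + real k) / real h) / 2 + (\<Sum>m\<le>M. c m)"
    by (subst sum.atMost_Suc_shift) (simp add: c_def algebra_simps)
  also have "(\<Sum>m\<le>M. c m) = (\<Sum>m\<le>M. half_step (real m) * c m + (if m = 0 then c 0 / 2 else 0))"
    by (intro sum.cong) auto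
  also have "\<dots> = weighted_lattice_count h k T + c 0 / 2"
    unfolding sum.distrib c_def
    using M T by (subst weighted_lattice_count_columns[OF h k T, of M]) auto
  finally show ?thesis by (simp add: c_def add_divide_distrib)
qed

section \<open>The quasi-polynomial and its increments\<close>

text \<open>The claimed value without the arctangent terms, in the variable
  \<open>T = h k t\<close>; so \<open>h t\<close> is \<open>T / k\<close> and \<open>k t\<close> is
  \<open>T / h\<close>.\<close>

definition quasi_polynomial :: "nat \<Rightarrow> nat \<Rightarrow> real \<Rightarrow> real" where
  "quasi_polynomial h k T = T\<^sup>2 / (2 * real h * real k) - B1_bar T * T / (real h * real k)
     + (B2_bar T + ((real h)\<^sup>2 + (real k)\<^sup>2) / 6) / (2 * real h * real k)
     - dedekind_rademacher_sum h k (T / real k) 0 - dedekind_rademacher_sum k h (T / real h) 0"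

lemma quasi_polynomial_commute: "quasi_polynomial h k T = quasi_polynomial k h T"
  by (simp add: quasi_polynomial_def algebra_simps)

lemma dedekind_rademacher_sum_add_one:
  "dedekind_rademacher_sum h k (y + 1) x = dedekind_rademacher_sum h k y x"
  by (simp add: dedekind_rademacher_sum_def flip: add.assoc)

text \<open>Replacing \<open>r\<close> by \<open>- r\<close> negates both arguments up to the sign
  of \<open>y\<close>, and \<open>B1_bar\<close> is odd. This serves negative
  \<open>t\<close>.\<close>

lemma dedekind_rademacher_sum_minus:
  assumes k: "0 < k"
  shows "dedekind_rademacher_sum h k (- y) 0 = dedekind_rademacher_sum h k y 0"
proof -
  define f where "f x = B1_bar (real h * x - y) * B1_bar x" for x
  have "f (x + 1) = f x" for x
    using periodic_add_int[of B1_bar "real h * x - y" "int h"] B1_bar_add_one[of x]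
    by (simp add: f_def algebra_simps)
  then have "(\<Sum>r<k. f (of_int (- 1) * real r / real k)) = (\<Sum>r<k. f (real r / real k))"
    using k by (intro sum_periodic_mult_coprime) auto
  moreover have "f (- x) = B1_bar (real h * x + y) * B1_bar x" for x
    using B1_bar_minus[of "real h * x + y"] by (simp add: f_def)
  then have "f (of_int (- 1) * real r / real k)
      = B1_bar (real h * (real r / real k) + y) * B1_bar (real r / real k)" for r
    by (simp only: of_int_minus of_int_1 mult_minus1 minus_divide_left[symmetric])
  ultimately show ?thesis
    by (simp only: dedekind_rademacher_sum_def f_def add_0_right diff_conv_add_uminus)
qed

text \<open>The slope is \<open>1 / h\<close>, but the steps leaving 0 and reaching 1 lose one half
  each, because \<open>B1_bar\<close> is 0 at integers. For \<open>h = 1\<close> both losses fall on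
  the same step.\<close>

lemma B1_bar_grid_difference:
  assumes h: "0 < h" and r: "r < h"
  shows "B1_bar (real (Suc r) / real h) - B1_bar (real r / real h)
    = 1 / real h - (if r = 0 then 1 / 2 else 0) - (if Suc r = h then 1 / 2 else 0)"
proof -
  have "B1_bar (real s / real h)
      = real s / real h - 1 / 2 + (if s = 0 then 1 / 2 else 0) - (if s = h then 1 / 2 else 0)"
    if "s \<le> h" for s
    using that h by (cases "s = 0"; cases "s = h") (auto simp: B1_bar_unit_interval)
  from this[of r] this[of "Suc r"] show ?thesis
    using r by (auto simp: add_divide_distrib)
qed

text \<open>Summation by parts: adding \<open>k\<close> to \<open>T\<close> turns the factor
  \<open>b r\<close> into \<open>b (r + 1)\<close>, so the index is shifted and the increments of
  the other factor are collected.\<close>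

lemma dedekind_rademacher_sum_shift:
  assumes h: "0 < h" and cop: "coprime h k"
  shows "dedekind_rademacher_sum k h ((T + real k) / real h) 0
    = dedekind_rademacher_sum k h (T / real h) 0
      - B1_bar T / real h + (B1_bar (T / real h) + B1_bar ((T + real k) / real h)) / 2"
proof -
  define b where "b r = B1_bar ((real k * real r + T) / real h)" for r
  define a where "a r = B1_bar (real r / real h)" for r
  have bh: "b h = b 0"
    using periodic_add_int[of B1_bar "T / real h" "int k"] h
    by (simp add: b_def add_divide_distrib add_ac)
  have ah: "a h = a 0" using h by (simp add: a_def)
  have sum: "(\<Sum>r<h. b (Suc r)) = B1_bar T"
    using sum_B1_bar_coprime[OF h cop, of "T + real k"] periodic_add_int[of B1_bar T "int k"]
    by (simp add: b_def algebra_simps)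
  have "dedekind_rademacher_sum k h (T / real h) 0 = (\<Sum>r<h. b r * a r)"
    by (simp add: dedekind_rademacher_sum_def a_def b_def add_divide_distrib)
  \<comment> \<open>The boundary terms agree because \<open>a\<close> and \<open>b\<close> take the
    same value at 0 and \<open>h\<close>.\<close>
  also have "\<dots> = (\<Sum>r<h. b (Suc r) * a (Suc r))"
    using sum_lessThan_telescope[of "\<lambda>r. b r * a r" h] ah bh by (simp add: sum_subtractf)
  also have "\<dots> = (\<Sum>r<h. b (Suc r) * a r + (1 / real h * b (Suc r)
      - (if r = 0 then b 1 / 2 else 0) - (if r = h - 1 then b h / 2 else 0)))"
  proof (intro sum.cong refl)
    fix r assume "r \<in> {..<h}"
    then have "a (Suc r) = a r + (1 / real h - (if r = 0 then 1 / 2 else 0)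
        - (if Suc r = h then 1 / 2 else 0))"
      using B1_bar_grid_difference[OF h, of r] by (simp add: a_def)
    moreover have "Suc r = h \<longleftrightarrow> r = h - 1" using h by auto
    moreover have "b (Suc r) * (a r + (1 / real h - (if r = 0 then 1 / 2 else 0)
        - (if Suc r = h then 1 / 2 else 0)))
      = b (Suc r) * a r + (1 / real h * b (Suc r)
        - (if r = 0 then b 1 / 2 else 0) - (if Suc r = h then b h / 2 else 0))"
      by (auto simp: distrib_left right_diff_distrib)
    ultimately show "b (Suc r) * a (Suc r) = b (Suc r) * a r + (1 / real h * b (Suc r)
      - (if r = 0 then b 1 / 2 else 0) - (if r = h - 1 then b h / 2 else 0))"
      by (simp only:)
  qed
  also have "\<dots> = (\<Sum>r<h. b (Suc r) * a r) + B1_bar T / real h - b 1 / 2 - b 0 / 2"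
    using h by (simp add: sum.distrib sum_subtractf bh sum flip: sum_distrib_left sum_divide_distrib)
  also have "(\<Sum>r<h. b (Suc r) * a r) = dedekind_rademacher_sum k h ((T + real k) / real h) 0"
    by (simp add: dedekind_rademacher_sum_def a_def b_def add_divide_distrib algebra_simps)
  finally show ?thesis by (simp add: b_def add_divide_distrib add.commute)
qed

text \<open>The term \<open>B1_bar T / h\<close> from the linear part cancels the one from the
  shifted Dedekind sum; the square contributes \<open>T / h + k / (2 h)\<close>, the mean of the two
  column heights.\<close>

lemma quasi_polynomial_shift:
  assumes h: "0 < h" and k: "0 < k" and cop: "coprime h k"
  shows "quasi_polynomial h k (T + real k) = quasi_polynomial h k T
    + (T / real h - B1_bar (T / real h)
      + ((T + real k) / real h - B1_bar ((T + real k) / real h))) / 2"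
proof -
  have "B1_bar (T + real k) = B1_bar T" "B2_bar (T + real k) = B2_bar T"
    using periodic_add_int[of B1_bar T "int k"] periodic_add_int[of B2_bar T "int k"] by simp_all
  moreover have "dedekind_rademacher_sum h k ((T + real k) / real k) 0
      = dedekind_rademacher_sum h k (T / real k) 0"
    using k dedekind_rademacher_sum_add_one[of h k "T / real k"] by (simp add: add_divide_distrib)
  moreover have "(T + real k)\<^sup>2 / (2 * real h * real k)
      = T\<^sup>2 / (2 * real h * real k) + T / real h + real k / (2 * real h)"
    "B1_bar T * (T + real k) / (real h * real k) = B1_bar T * T / (real h * real k) + B1_bar T / real h"
    using h k by (simp_all add: field_simps power2_eq_square)
  moreover have "(T + real k) / real h = T / real h + 2 * (real k / (2 * real h))"
    by (simp add: add_divide_distrib)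
  ultimately show ?thesis
    unfolding quasi_polynomial_def dedekind_rademacher_sum_shift[OF h cop]
    by (simp add: field_simps)
qed

section \<open>Initial values and equality of the two sides\<close>

lemma quasi_polynomial_0:
  assumes "0 < h" "0 < k" "coprime h k"
  shows "quasi_polynomial h k 0 = 1 / 4"
  using dedekind_reciprocity[OF assms] assms(1,2)
  by (simp add: quasi_polynomial_def B2_bar_def B2_def field_simps power2_eq_square)

text \<open>Moving from \<open>N / k\<close> by less than \<open>1 / k\<close> meets no integer, so
  \<open>B1_bar\<close> stays on one linear piece.\<close>

lemma B1_bar_add_small:
  assumes k: "0 < k" and N: "\<not> k dvd N" and T: "0 < T" "T < 1"
  shows "B1_bar ((real N + T) / real k) = B1_bar (real N / real k) + T / real k"
proof -
  define q where "q = N mod k"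
  have q: "0 < q" "q < k" using N k by (auto simp: q_def mod_greater_zero_iff_not_dvd)
  have "real N = real q + real (N div k) * real k"
    unfolding q_def by (metis mod_div_mult_eq of_nat_add of_nat_mult)
  then have *: "(real N + x) / real k = (real q + x) / real k + of_int (int (N div k))" for x
    using k by (simp add: field_simps)
  have "B1_bar ((real N + x) / real k) = (real q + x) / real k - 1 / 2" if "0 \<le> x" "x < 1" for x
  proof -
    have "real q + x < real k" using q that by linarith
    then have "B1_bar ((real q + x) / real k) = (real q + x) / real k - 1 / 2"
      using q that by (intro B1_bar_unit_interval) auto
    then show ?thesis unfolding * by (subst periodic_add_int) auto
  qed
  from this[of T] this[of 0] show ?thesis using T by (simp add: add_divide_distrib)
qed

text \<open>The term \<open>r = 0\<close> is 0, and every other one changes by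
  \<open>T / k * B1_bar (r / k)\<close>; these changes sum to 0.\<close>

lemma dedekind_rademacher_sum_small:
  assumes k: "0 < k" and cop: "coprime h k" and T: "0 < T" "T < 1"
  shows "dedekind_rademacher_sum h k (T / real k) 0 = dedekind_rademacher_sum h k 0 0"
proof -
  have "B1_bar ((real h * real r + T) / real k) * B1_bar (real r / real k)
      = B1_bar (real h * real r / real k) * B1_bar (real r / real k)
        + T / real k * B1_bar (real r / real k)" if "r < k" for r
  proof (cases "r = 0")
    case False
    with that have "\<not> k dvd r" by (auto dest: dvd_imp_le)
    then have "\<not> k dvd h * r" using cop by (simp add: coprime_dvd_mult_right_iff coprime_commute)
    from B1_bar_add_small[OF k this T] show ?thesis by (simp add: algebra_simps)
  qed simp
  then have "dedekind_rademacher_sum h k (T / real k) 0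
      = dedekind_rademacher_sum h k 0 0 + T / real k * (\<Sum>r<k. B1_bar (real r / real k))"
    by (simp add: dedekind_rademacher_sum_def add_divide_distrib sum.distrib sum_distrib_left)
  also have "(\<Sum>r<k. B1_bar (real r / real k)) = 0"
    using sum_B1_bar_equidistant[OF k, of 0] by simp
  finally show ?thesis by simp
qed

lemma weighted_lattice_count_small:
  assumes h: "0 < h" and k: "0 < k" and cop: "coprime h k" and T: "0 < T" "T < 1"
  shows "weighted_lattice_count h k T = quasi_polynomial h k T"
proof -
  have "T < real h" "T < real k" using h k T by linarith+
  then have "weighted_lattice_count h k T = 1 / 4"
    using T h by (subst weighted_lattice_count_columns[OF h k, of T 1])
      (auto simp: column_count_def B1_bar_unit_interval divide_less_0_iff)
  \<comment> \<open>On the unit interval the powers of \<open>T\<close> from the square,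
    \<open>B1_bar\<close> and \<open>B2_bar\<close> cancel.\<close>
  moreover have "quasi_polynomial h k T = quasi_polynomial h k 0"
    using T dedekind_rademacher_sum_small[OF k cop T] dedekind_rademacher_sum_small[of h k, OF h _ T] cop h k
    by (simp add: quasi_polynomial_def coprime_commute B1_bar_unit_interval B2_bar_def B2_def
        floor_unique[of 0] field_simps power2_eq_square)
  ultimately show ?thesis using quasi_polynomial_0[OF h k cop] by simp
qed

text \<open>At \<open>T = 0\<close> the two sides differ, \<open>1 / 8\<close> against
  \<open>1 / 4\<close>. The shift by \<open>k\<close> repairs this:
  \<open>column_count 0 / 2\<close> supplies the missing \<open>1 / 8\<close>.\<close>

lemma weighted_lattice_count_at_k:
  assumes h: "0 < h" and k: "0 < k" and cop: "coprime h k"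
  shows "weighted_lattice_count h k (real k) = quasi_polynomial h k (real k)"
proof -
  have "weighted_lattice_count h k 0 = 1 / 8"
    by (simp add: weighted_lattice_count_def)
  then show ?thesis
    using weighted_lattice_count_shift[OF h k, of 0] quasi_polynomial_shift[OF h k cop, of 0]
      quasi_polynomial_0[OF h k cop] h k
    by (simp add: add_divide_distrib diff_divide_distrib)
qed

theorem weighted_lattice_count_formula:
  assumes h: "0 < h" and k: "0 < k" and cop: "coprime h k" and T: "0 < T"
  shows "weighted_lattice_count h k T = quasi_polynomial h k T"
proof -
  define D where "D T = weighted_lattice_count h k T - quasi_polynomial h k T" for T
  have stepk: "D (T + real k) = D T" if "0 < T" for T
    using weighted_lattice_count_shift[OF h k, of T] quasi_polynomial_shift[OF h k cop, of T] h k that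
    by (simp add: D_def)
  have steph: "D (T + real h) = D T" if "0 < T" for T
    using weighted_lattice_count_shift[OF k h, of T] quasi_polynomial_shift[of k h T] h k cop that
    by (simp add: D_def coprime_commute weighted_lattice_count_commute[of h k]
        quasi_polynomial_commute[of h k])
  have multk: "D (T + real (n * k)) = D T" if "0 < T" for T n
    using stepk[of "T + real (n * k)" for n] that
    by (induction n) (auto simp: algebra_simps add_pos_nonneg)
  have multh: "D (T + real (n * h)) = D T" if "0 < T" for T n
    using steph[of "T + real (n * h)" for n] that
    by (induction n) (auto simp: algebra_simps add_pos_nonneg)
  obtain a b where ab: "k * a = h * b + 1"
    using bezout_nat[of k h] cop k by (auto simp: coprime_iff_gcd_eq_1 gcd.commute)
  have one: "D (T + 1) = D T" if "0 < T" for T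
  proof -
    \<comment> \<open>Going up by \<open>b h\<close> and down by \<open>a k\<close> keeps all
      arguments positive, where periodicity is known.\<close>
    have "D (T + 1) = D (T + 1 + real (b * h))" using that by (simp only: multh)
    also have "T + 1 + real (b * h) = T + real (a * k)"
      using arg_cong[OF ab, of real] by (simp add: algebra_simps)
    also have "D \<dots> = D T" using that by (simp only: multk)
    finally show ?thesis .
  qed
  have nat: "D (T + real n) = D T" if "0 < T" for T n
    using one[of "T + real n" for n] that
    by (induction n) (auto simp: algebra_simps add_pos_nonneg)
  have "D T = 0"
  proof (cases "T \<in> \<int>")
    case True
    then obtain n where "T = 1 + real n"
      using T by (metis Ints_cases add.commute of_int_0_less_iff of_nat_Suc of_int_of_nat_eq zero_less_imp_eq_int gr0_implies_Suc)
    \<comment> \<open>The fractional part 0 of an integer is out of reach, so \<open>k\<close> is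
      the reference point instead.\<close>
    then have "D T = D (1 + real (k - 1))" by (simp only: nat zero_less_one)
    also have "\<dots> = 0"
      using weighted_lattice_count_at_k[OF h k cop] k by (simp add: D_def of_nat_diff)
    finally show ?thesis .
  next
    case False
    then have f: "0 < frac T" "frac T < 1" by (auto simp: frac_lt_1 frac_gt_0_iff)
    have "T = frac T + real (nat \<lfloor>T\<rfloor>)" using T by (simp add: frac_def)
    then have "D T = D (frac T)" using nat[OF f(1)] by metis
    then show ?thesis using weighted_lattice_count_small[OF h k cop f] by (simp add: D_def)
  qed
  then show ?thesis by (simp add: D_def)
qed

section \<open>Solid angles of a right triangle\<close>

text \<open>Faces of a simplex are the hulls of subsets of its vertices, and dimension 1 means two
  vertices.\<close>

lemma edge_of_triangle:
  fixes p q r :: "'a::euclidean_space"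
  assumes ind: "\<not> affine_dependent {p, q, r}" and dist: "p \<noteq> q" "p \<noteq> r" "q \<noteq> r"
  shows "e edge_of convex hull {p, q, r} \<longleftrightarrow>
    e = closed_segment p q \<or> e = closed_segment p r \<or> e = closed_segment q r"
proof
  assume "e edge_of convex hull {p, q, r}"
  then obtain c where c: "c \<subseteq> {p, q, r}" "e = convex hull c" and dim: "aff_dim e = 1"
    unfolding edge_of_def face_of_convex_hull_affine_independent[OF ind] by blast
  have "\<not> affine_dependent c" using ind c(1) affine_dependent_subset by blast
  then have "card c = 2"
    using dim aff_dim_affine_independent[of c] by (simp add: c(2) aff_dim_convex_hull)
  then obtain u v where "c = {u, v}" "u \<noteq> v" by (auto simp: card_2_iff)
  then have "c = {p, q} \<or> c = {p, r} \<or> c = {q, r}" using c(1) by auto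
  then show "e = closed_segment p q \<or> e = closed_segment p r \<or> e = closed_segment q r"
    by (auto simp: c(2) segment_convex_hull)
next
  have "closed_segment u v edge_of convex hull {p, q, r}" if "{u, v} \<subseteq> {p, q, r}" "u \<noteq> v" for u v
    unfolding edge_of_def face_of_convex_hull_affine_independent[OF ind]
    using that by (intro conjI exI[of _ "{u, v}"]) (simp_all add: segment_convex_hull aff_dim_convex_hull)
  then show "e edge_of convex hull {p, q, r}"
    if "e = closed_segment p q \<or> e = closed_segment p r \<or> e = closed_segment q r"
    using that dist by auto
qed

lemma angle_between_commute: "angle_between u v = angle_between v u"
  by (simp add: angle_between_def inner_commute mult.commute)

text \<open>The edges at \<open>p\<close> end in \<open>q\<close> and \<open>r\<close>; the
  description is unambiguous because the angle is symmetric.\<close>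

lemma interior_angle_triangle:
  assumes ind: "\<not> affine_dependent {p, q, r}" and dist: "p \<noteq> q" "p \<noteq> r" "q \<noteq> r"
  shows "interior_angle (convex hull {p, q, r}) p = angle_between (q - p) (r - p)"
proof -
  have "closed_segment p a edge_of convex hull {p, q, r} \<longleftrightarrow> a = q \<or> a = r" for a
    using dist by (auto simp: edge_of_triangle[OF ind dist] doubleton_eq_iff)
  then have "interior_angle (convex hull {p, q, r}) p = (THE \<theta>. \<exists>a b. a \<noteq> b \<and>
      (a = q \<or> a = r) \<and> (b = q \<or> b = r) \<and> \<theta> = angle_between (a - p) (b - p))"
    by (simp only: interior_angle_def)
  also have "\<dots> = angle_between (q - p) (r - p)"
    using dist(3) angle_between_commute by (intro the_equality) blast+
  finally show ?thesis .
qed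

text \<open>The left side is the angle at \<open>(a, 0)\<close>, between \<open>(-a, 0)\<close> and
  \<open>(-a, b)\<close>. The right side splits off the right angle that the weight
  \<open>1 / 4\<close> stands for.\<close>

lemma arccos_arctan_right_triangle:
  assumes "a \<noteq> 0" "b \<noteq> (0::real)"
  shows "arccos (a\<^sup>2 / (\<bar>a\<bar> * sqrt (a\<^sup>2 + b\<^sup>2))) = pi / 2 - arctan \<bar>a / b\<bar>"
proof -
  have "a\<^sup>2 / (\<bar>a\<bar> * sqrt (a\<^sup>2 + b\<^sup>2)) = \<bar>a\<bar> / sqrt (a\<^sup>2 + b\<^sup>2)"
    using assms by (auto simp: power2_eq_square abs_if field_simps)
  also have "\<dots> = cos (arctan \<bar>b / a\<bar>)"
  proof -
    have "1 + \<bar>b / a\<bar>\<^sup>2 = (a\<^sup>2 + b\<^sup>2) / a\<^sup>2"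
      using assms by (simp add: power_divide add_divide_distrib)
    then show ?thesis by (simp only: cos_arctan) (simp add: real_sqrt_divide)
  qed
  finally have "arccos (a\<^sup>2 / (\<bar>a\<bar> * sqrt (a\<^sup>2 + b\<^sup>2))) = arctan \<bar>b / a\<bar>"
    using arctan_ubound[of "\<bar>b / a\<bar>"] pi_gt_zero zero_le_arctan_iff[of "\<bar>b / a\<bar>"]
    by (simp only:) (intro arccos_cos; linarith)
  also have "\<dots> = arctan (1 / \<bar>a / b\<bar>)" by simp
  also have "\<dots> = pi / 2 - arctan \<bar>a / b\<bar>"
    using assms arctan_inverse[of "\<bar>a / b\<bar>"] by simp
  finally show ?thesis .
qed

context
  fixes a b :: real
  assumes a: "a \<noteq> 0" and b: "b \<noteq> 0"
begin

text \<open>\<open>x / a\<close> and \<open>y / b\<close> are the barycentric weights of the acute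
  vertices, which treats legs of either sign alike.\<close>

lemma mem_right_triangle:
  "(x, y) \<in> convex hull {(0, 0), (a, 0), (0, b)} \<longleftrightarrow> 0 \<le> x / a \<and> 0 \<le> y / b \<and> x / a + y / b \<le> 1"
proof
  assume *: "0 \<le> x / a \<and> 0 \<le> y / b \<and> x / a + y / b \<le> 1"
  have "(x, y) = (1 - x / a - y / b) *\<^sub>R (0, 0) + (x / a) *\<^sub>R (a, 0) + (y / b) *\<^sub>R (0, b)"
    using a b by simp
  then show "(x, y) \<in> convex hull {(0, 0), (a, 0), (0, b)}"
    unfolding convex_hull_3 mem_Collect_eq using * by (intro exI conjI) (assumption, auto)
next
  assume "(x, y) \<in> convex hull {(0, 0), (a, 0), (0, b)}"
  then obtain u v w where "0 \<le> u" "0 \<le> v" "0 \<le> w" "u + v + w = 1" "x = v * a" "y = w * b"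
    unfolding convex_hull_3 by auto
  then show "0 \<le> x / a \<and> 0 \<le> y / b \<and> x / a + y / b \<le> 1" using a b by simp
qed

text \<open>The triangle is an intersection of three half-planes, whose interiors are the strict
  half-planes.\<close>

lemma mem_interior_right_triangle:
  "(x, y) \<in> interior (convex hull {(0, 0), (a, 0), (0, b)}) \<longleftrightarrow>
    0 < x / a \<and> 0 < y / b \<and> x / a + y / b < 1"
proof -
  have "convex hull {(0, 0), (a, 0), (0, b)}
      = {p. (1 / a, 0) \<bullet> p \<ge> 0} \<inter> {p. (0, 1 / b) \<bullet> p \<ge> 0} \<inter> {p. (1 / a, 1 / b) \<bullet> p \<le> 1}"
    by (auto simp: mem_right_triangle)
  then have "interior (convex hull {(0, 0), (a, 0), (0, b)})
      = {p. (1 / a, 0) \<bullet> p > 0} \<inter> {p. (0, 1 / b) \<bullet> p > 0} \<inter> {p. (1 / a, 1 / b) \<bullet> p < 1}"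
    using a b by (simp add: zero_prod_def)
  then show ?thesis by simp
qed

lemma right_triangle_affine_independent: "\<not> affine_dependent {(0, 0), (a, 0), (0, b)}"
  using a b collinear_3_eq_affine_dependent[of "(0, 0)" "(a, 0)" "(0, b)"]
    collinear_lemma[of "(a, 0)" "(0, b)"]
  by (auto simp: zero_prod_def)

lemma edge_interior_right_triangle:
  "(\<exists>e. e edge_of convex hull {(0, 0), (a, 0), (0, b)} \<and> (x, y) \<in> rel_interior e) \<longleftrightarrow>
    (y / b = 0 \<and> 0 < x / a \<and> x / a < 1) \<or> (x / a = 0 \<and> 0 < y / b \<and> y / b < 1) \<or>
    (0 < x / a \<and> 0 < y / b \<and> x / a + y / b = 1)"
proof -
  have "(x, y) \<in> open_segment (0, 0) (a, 0) \<longleftrightarrow> y / b = 0 \<and> 0 < x / a \<and> x / a < 1"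
    using a b by (auto simp: in_segment intro!: exI[of _ "x / a"])
  moreover have "(x, y) \<in> open_segment (0, 0) (0, b) \<longleftrightarrow> x / a = 0 \<and> 0 < y / b \<and> y / b < 1"
    using a b by (auto simp: in_segment intro!: exI[of _ "y / b"])
  moreover have "(x, y) \<in> open_segment (a, 0) (0, b) \<longleftrightarrow> 0 < x / a \<and> 0 < y / b \<and> x / a + y / b = 1"
  proof
    assume *: "0 < x / a \<and> 0 < y / b \<and> x / a + y / b = 1"
    then have "1 - y / b = x / a" by linarith
    then have "x = (1 - y / b) * a" using a by simp
    then show "(x, y) \<in> open_segment (a, 0) (0, b)"
      using * a b by (auto simp: in_segment intro!: exI[of _ "y / b"])
  qed (use a b in \<open>auto simp: in_segment\<close>)
  ultimately show ?thesis
    using a b edge_of_triangle[OF right_triangle_affine_independent]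
    by (simp add: rel_interior_closed_segment ex_disj_distrib conj_disj_distribR)
qed

lemma right_triangle_interior_angles:
  defines "P \<equiv> convex hull {(0, 0), (a, 0), (0, b)}"
  shows "interior_angle P (0, 0) = pi / 2"
    and "interior_angle P (a, 0) = pi / 2 - arctan \<bar>a / b\<bar>"
    and "interior_angle P (0, b) = pi / 2 - arctan \<bar>b / a\<bar>"
proof -
  note ind = right_triangle_affine_independent
  show "interior_angle P (0, 0) = pi / 2"
    unfolding P_def using a b
    by (subst interior_angle_triangle[OF ind]) (auto simp: angle_between_def)
  \<comment> \<open>The vertices are reordered to put the one in question first.\<close>
  have "P = convex hull {(a, 0), (0, 0), (0, b)}"
    "\<not> affine_dependent {(a, 0), (0, 0), (0, b)}"
    using ind by (simp_all add: P_def insert_commute)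
  then show "interior_angle P (a, 0) = pi / 2 - arctan \<bar>a / b\<bar>"
    using a b arccos_arctan_right_triangle[OF a b]
    by (simp add: interior_angle_triangle angle_between_def norm_prod_def power2_eq_square)
  have "P = convex hull {(0, b), (0, 0), (a, 0)}"
    "\<not> affine_dependent {(0, b), (0, 0), (a, 0)}"
    using ind by (simp_all add: P_def insert_commute)
  then show "interior_angle P (0, b) = pi / 2 - arctan \<bar>b / a\<bar>"
    using a b arccos_arctan_right_triangle[OF b a]
    by (simp add: interior_angle_triangle angle_between_def norm_prod_def power2_eq_square add.commute)
qed

text \<open>The product is right everywhere but at the acute vertices: it gives \<open>1 / 4\<close>
  there, while the angle is \<open>pi / 2\<close> minus an arctangent.\<close>

lemma solid_angle_right_triangle:
  "solid_angle (convex hull {(0, 0), (a, 0), (0, b)}) (x, y)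
    = half_step (x / a) * half_step (y / b) * half_step (1 - x / a - y / b)
      - (if (x, y) = (a, 0) then arctan \<bar>a / b\<bar> / (2 * pi) else 0)
      - (if (x, y) = (0, b) then arctan \<bar>b / a\<bar> / (2 * pi) else 0)"
proof -
  define P where "P = convex hull {(0, 0), (a, 0), (0, b)}"
  have ext: "p extreme_point_of P \<longleftrightarrow> p \<in> {(0, 0), (a, 0), (0, b)}" for p
    unfolding P_def
    by (rule extreme_point_of_convex_hull_affine_independent[OF right_triangle_affine_independent])
  define u v where "u = x / a" and "v = y / b"
  have xy: "x = u * a" "y = v * b" using a b by (simp_all add: u_def v_def)
  have vertex: "(x, y) = (0, 0) \<longleftrightarrow> u = 0 \<and> v = 0" "(x, y) = (a, 0) \<longleftrightarrow> u = 1 \<and> v = 0"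
    "(x, y) = (0, b) \<longleftrightarrow> u = 0 \<and> v = 1"
    using a b by (auto simp: xy)
  have sa: "solid_angle P (x, y) =
     (if 0 < u \<and> 0 < v \<and> u + v < 1 then 1
      else if \<not> (0 \<le> u \<and> 0 \<le> v \<and> u + v \<le> 1) then 0
      else if v = 0 \<and> 0 < u \<and> u < 1 \<or> u = 0 \<and> 0 < v \<and> v < 1 \<or> 0 < u \<and> 0 < v \<and> u + v = 1
        then 1 / 2
      else if u = 0 \<and> v = 0 \<or> u = 1 \<and> v = 0 \<or> u = 0 \<and> v = 1 then interior_angle P (x, y) / (2 * pi)
      else 0)"
    unfolding solid_angle_def ext insert_iff empty_iff vertex
    by (simp only: P_def mem_right_triangle mem_interior_right_triangle edge_interior_right_triangle
        simp_thms flip: u_def v_def)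
  note angle = right_triangle_interior_angles[folded P_def]
  \<comment> \<open>Outside, interior, the three open edges, the three vertices.\<close>
  consider "u < 0 \<or> v < 0 \<or> u + v > 1" | "0 < u \<and> 0 < v \<and> u + v < 1"
    | "v = 0 \<and> 0 < u \<and> u < 1" | "u = 0 \<and> 0 < v \<and> v < 1" | "0 < u \<and> 0 < v \<and> u + v = 1"
    | "u = 0 \<and> v = 0" | "u = 1 \<and> v = 0" | "u = 0 \<and> v = 1"
    by linarith
  then have "solid_angle P (x, y) = half_step u * half_step v * half_step (1 - u - v)
      - (if u = 1 \<and> v = 0 then arctan \<bar>a / b\<bar> / (2 * pi) else 0)
      - (if u = 0 \<and> v = 1 then arctan \<bar>b / a\<bar> / (2 * pi) else 0)"
  proof cases
    case 1
    then have "\<not> (0 < u \<and> 0 < v \<and> u + v < 1)" "\<not> (0 \<le> u \<and> 0 \<le> v \<and> u + v \<le> 1)"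
      "\<not> (u = 1 \<and> v = 0)" "\<not> (u = 0 \<and> v = 1)" by linarith+
    moreover have "half_step u * half_step v * half_step (1 - u - v) = 0" using 1 by fastforce
    ultimately show ?thesis by (simp only: sa if_False if_True) simp
  next
    case 5
    then have "1 - u - v = 0" by simp
    with 5 show ?thesis by (simp add: sa)
  next
    case 6
    then have p: "(x, y) = (0, 0)" by (simp only: vertex)
    from 6 have "solid_angle P (x, y) = interior_angle P (x, y) / (2 * pi)" by (simp add: sa)
    then show ?thesis using 6 unfolding p angle by simp
  next
    case 7
    then have p: "(x, y) = (a, 0)" by (simp only: vertex)
    from 7 have "solid_angle P (x, y) = interior_angle P (x, y) / (2 * pi)" by (simp add: sa)
    then show ?thesis using 7 unfolding p angle by (simp add: diff_divide_distrib)
  next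
    case 8
    then have p: "(x, y) = (0, b)" by (simp only: vertex)
    from 8 have "solid_angle P (x, y) = interior_angle P (x, y) / (2 * pi)" by (simp add: sa)
    then show ?thesis using 8 unfolding p angle by (simp add: diff_divide_distrib)
  qed (simp_all add: sa)
  then show ?thesis by (simp only: P_def vertex u_def v_def)
qed

end

section \<open>The solid-angle sum\<close>

lemma solid_angle_nonzero_imp_mem: "solid_angle P x \<noteq> 0 \<Longrightarrow> x \<in> P"
  using interior_subset by (auto simp: solid_angle_def split: if_splits)

lemma solid_angle_sum_eq_weighted_lattice_count:
  fixes h k :: nat and t :: real
  assumes h: "0 < h" and k: "0 < k" and t: "t \<noteq> 0"
  shows "solid_angle_sum (convex hull {(0, 0), (real h, 0), (0, real k)}) t
    = weighted_lattice_count h k (real h * real k * \<bar>t\<bar>)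
      - arctan (real h / real k) / (2 * pi) * indicator \<int> (real h * t)
      - arctan (real k / real h) / (2 * pi) * indicator \<int> (real k * t)"
proof -
  define a b T c where "a = real h * t" and "b = real k * t"
    and "T = real h * real k * \<bar>t\<bar>" and "c = sgn t"
  have a: "a \<noteq> 0" and b: "b \<noteq> 0" using h k t by (auto simp: a_def b_def)
  have c: "c = 1 \<or> c = - 1" using t by (auto simp: c_def sgn_if)
  have T: "0 < T" using h k t by (simp add: T_def)
  define P where "P = convex hull {(0, 0), (a, 0), (0, b)}"
  have scale: "(*\<^sub>R) t ` (convex hull {(0, 0), (real h, 0), (0, real k)}) = P"
    using convex_hull_scaling[of t "{(0, 0), (real h, 0), (0, real k)}"]
    by (simp add: P_def a_def b_def mult.commute)
  define M where "M = nat \<lceil>T\<rceil>"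
  have TM: "T \<le> real M" by (simp add: M_def of_nat_ceiling)
  have aM: "\<bar>a\<bar> \<le> real M" "\<bar>b\<bar> \<le> real M"
  proof -
    have "real h * 1 \<le> real h * real k" "real k * 1 \<le> real k * real h"
      using h k by (intro mult_left_mono; simp)+
    then have "real h * \<bar>t\<bar> \<le> T" "real k * \<bar>t\<bar> \<le> T"
      unfolding T_def by (intro mult_right_mono; simp add: mult.commute)+
    then show "\<bar>a\<bar> \<le> real M" "\<bar>b\<bar> \<le> real M" using TM by (simp_all add: a_def b_def abs_mult)
  qed
  \<comment> \<open>The sign \<open>c\<close> reflects the first quadrant onto the one containing
    the triangle; \<open>S\<close> is a finite box of lattice points covering its support.\<close>
  define \<iota> where "\<iota> = (\<lambda>(m, n). (c * real m, c * real n))"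
  define S where "S = \<iota> ` ({..M} \<times> {..M})"
  have S_Ints: "S \<subseteq> \<int> \<times> \<int>" using c by (auto simp: S_def \<iota>_def)
  have coord: "\<exists>m\<le>M. x = c * real m" if "x \<in> \<int>" "0 \<le> x / (l * t)" "x / (l * t) \<le> 1" "0 < l"
    "\<bar>l * t\<bar> \<le> real M" for x l :: real
  proof -
    have "\<bar>x\<bar> / \<bar>l * t\<bar> \<le> 1" using that(2,3) by (simp flip: abs_divide)
    then have le: "\<bar>x\<bar> \<le> real M" using that(4,5) t by (simp add: divide_le_eq_1)
    obtain z where z: "x = of_int z" using \<open>x \<in> \<int>\<close> Ints_cases by blast
    have "x = c * \<bar>x\<bar>" using that(2,4) t
      by (auto simp: c_def sgn_if abs_if zero_le_divide_iff zero_le_mult_iff mult_le_0_iff)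
    then have "x = c * real (nat \<bar>z\<bar>)" by (simp add: z)
    moreover have "nat \<bar>z\<bar> \<le> M" using le by (simp add: z nat_le_iff flip: of_int_abs)
    ultimately show ?thesis by blast
  qed
  have support: "p \<in> S" if "p \<in> \<int> \<times> \<int>" "p \<in> P" for p
  proof -
    obtain x y where p: "p = (x, y)" by fastforce
    have mem: "0 \<le> x / a" "0 \<le> y / b" "x / a + y / b \<le> 1"
      using that(2) by (simp_all only: p P_def mem_right_triangle[OF a b])
    then have le: "x / a \<le> 1" "y / b \<le> 1" by linarith+
    have "\<exists>m\<le>M. x = c * real m"
      using coord[of x "real h", folded a_def] mem(1) le(1) h aM(1) that(1) by (simp add: p)
    moreover have "\<exists>n\<le>M. y = c * real n"
      using coord[of y "real k", folded b_def] mem(2) le(2) k aM(2) that(1) by (simp add: p)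
    ultimately obtain m n where "m \<le> M" "n \<le> M" "x = c * real m" "y = c * real n" by blast
    then show ?thesis by (auto simp: S_def \<iota>_def p)
  qed
  \<comment> \<open>An arctangent correction occurs only if its vertex is a lattice point.\<close>
  have vert: "(a, 0) \<in> S \<longleftrightarrow> a \<in> \<int>" "(0, b) \<in> S \<longleftrightarrow> b \<in> \<int>"
    using support[of "(a, 0)"] support[of "(0, b)"] S_Ints a b
    by (auto simp: P_def mem_right_triangle[OF a b])
  define w where "w = (\<lambda>(x, y). half_step (x / a) * half_step (y / b) * half_step (1 - x / a - y / b))"
  have "solid_angle_sum (convex hull {(0, 0), (real h, 0), (0, real k)}) t
      = infsum (solid_angle P) (\<int> \<times> \<int>)"
    by (simp only: solid_angle_sum_def scale)
  also have "\<dots> = infsum (solid_angle P) S"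
    using support S_Ints solid_angle_nonzero_imp_mem by (intro infsum_cong_neutral) blast+
  also have "\<dots> = sum (solid_angle P) S"
    by (rule infsum_finite) (simp add: S_def)
  also have "\<dots> = (\<Sum>p\<in>S. w p - (if p = (a, 0) then arctan \<bar>a / b\<bar> / (2 * pi) else 0)
      - (if p = (0, b) then arctan \<bar>b / a\<bar> / (2 * pi) else 0))"
  proof (intro sum.cong refl)
    fix p
    show "solid_angle P p = w p - (if p = (a, 0) then arctan \<bar>a / b\<bar> / (2 * pi) else 0)
      - (if p = (0, b) then arctan \<bar>b / a\<bar> / (2 * pi) else 0)"
      by (cases p) (simp only: P_def w_def solid_angle_right_triangle[OF a b] prod.case)
  qed
  also have "\<dots> = sum w S - arctan \<bar>a / b\<bar> / (2 * pi) * indicator \<int> a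
      - arctan \<bar>b / a\<bar> / (2 * pi) * indicator \<int> b"
  proof -
    have "finite S" by (simp add: S_def)
    then show ?thesis by (simp add: sum_subtractf vert)
  qed
  also have "sum w S = (\<Sum>p\<in>{..M} \<times> {..M}. w (\<iota> p))"
    unfolding S_def using c by (subst sum.reindex) (auto simp: \<iota>_def inj_on_def)
  also have "\<dots> = weighted_lattice_count h k T"
  proof -
    have ct: "c * x / (l * t) = x / (l * \<bar>t\<bar>)" for x l
      using t by (auto simp: c_def sgn_if abs_if)
    have "w (\<iota> (m, n)) = half_step (real m) * half_step (real n)
        * half_step (T - real k * real m - real h * real n)" for m n
    proof -
      \<comment> \<open>Each argument is a positive multiple of the one in the count, and
        \<open>half_step\<close> ignores positive factors.\<close>
      have "real m / (real h * \<bar>t\<bar>) = 1 / (real h * \<bar>t\<bar>) * real m"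
        "real n / (real k * \<bar>t\<bar>) = 1 / (real k * \<bar>t\<bar>) * real n"
        "T - real k * real m - real h * real n
          = T * (1 - real m / (real h * \<bar>t\<bar>) - real n / (real k * \<bar>t\<bar>))"
        using h k t by (simp_all add: T_def field_simps)
      moreover have "0 < 1 / (real h * \<bar>t\<bar>)" "0 < 1 / (real k * \<bar>t\<bar>)" using h k t by simp_all
      ultimately show ?thesis
        unfolding w_def \<iota>_def a_def b_def prod.case ct using T half_step_cmult by metis
    qed
    then show ?thesis
      unfolding weighted_lattice_count_eq[OF h k TM] sum.cartesian_product
      by (intro sum.cong) auto
  qed
  also have "\<bar>a / b\<bar> = real h / real k" using t by (simp add: a_def b_def)
  also have "\<bar>b / a\<bar> = real k / real h" using t by (simp add: a_def b_def)
  finally show ?thesis by (simp only: a_def b_def T_def)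
qed

text \<open>Passing from the absolute value of \<open>t\<close> to \<open>t\<close> is harmless:
  \<open>B1_bar\<close> is odd but multiplied by an odd factor, and the other terms are
  even.\<close>

lemma quasi_polynomial_abs:
  assumes h: "0 < h" and k: "0 < k"
  shows "quasi_polynomial h k (real h * real k * \<bar>t\<bar>) =
      real h * real k / 2 * t\<^sup>2 - B1_bar (real h * real k * t) * t
      + 1 / (2 * real h * real k)
          * (B2_bar (real h * real k * t) + ((real h)\<^sup>2 + (real k)\<^sup>2) / 6)
      - dedekind_rademacher_sum h k (real h * t) 0
      - dedekind_rademacher_sum k h (real k * t) 0"
proof -
  have "B1_bar (real h * real k * \<bar>t\<bar>) * \<bar>t\<bar> = B1_bar (real h * real k * t) * t"
    "B2_bar (real h * real k * \<bar>t\<bar>) = B2_bar (real h * real k * t)"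
    "dedekind_rademacher_sum h k (real h * \<bar>t\<bar>) 0 = dedekind_rademacher_sum h k (real h * t) 0"
    "dedekind_rademacher_sum k h (real k * \<bar>t\<bar>) 0 = dedekind_rademacher_sum k h (real k * t) 0"
    using h k by (cases "0 \<le> t"; simp add: dedekind_rademacher_sum_minus)+
  moreover have "(real h * real k * \<bar>t\<bar>)\<^sup>2 / (2 * real h * real k) = real h * real k / 2 * t\<^sup>2"
    "B1_bar (real h * real k * \<bar>t\<bar>) * (real h * real k * \<bar>t\<bar>) / (real h * real k)
      = B1_bar (real h * real k * \<bar>t\<bar>) * \<bar>t\<bar>"
    "real h * real k * \<bar>t\<bar> / real k = real h * \<bar>t\<bar>" "real h * real k * \<bar>t\<bar> / real h = real k * \<bar>t\<bar>"
    using h k by (simp_all add: power2_eq_square field_simps)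
  ultimately show ?thesis
    by (simp add: quasi_polynomial_def)
qed

theorem mainTheorem1:
  fixes h k :: nat and \<Delta> :: "(real \<times> real) set" and t :: real
  assumes "0 < h" and "0 < k" and "coprime h k"
    and "\<Delta> = convex hull {(0, 0), (real h, 0), (0, real k)}"
    and "t \<noteq> 0"
  shows "solid_angle_sum \<Delta> t =
      real h * real k / 2 * t\<^sup>2 - B1_bar (real h * real k * t) * t
      + 1 / (2 * real h * real k)
          * (B2_bar (real h * real k * t) + ((real h)\<^sup>2 + (real k)\<^sup>2) / 6)
      - dedekind_rademacher_sum h k (real h * t) 0
      - dedekind_rademacher_sum k h (real k * t) 0
      - arctan (real h / real k) / (2 * pi) * indicator \<int> (real h * t)
      - arctan (real k / real h) / (2 * pi) * indicator \<int> (real k * t)"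
proof -
  have "0 < real h * real k * \<bar>t\<bar>" using assms(1,2,5) by simp
  from weighted_lattice_count_formula[OF assms(1-3) this] show ?thesis
    unfolding assms(4) solid_angle_sum_eq_weighted_lattice_count[OF assms(1,2,5)]
    by (simp only: quasi_polynomial_abs[OF assms(1,2)])
qed

end
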